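(* Let $F$ be a field of characteristic zero and $n\ge4$. Let $A=UT_n(F)$ be the algebra of $n\times n$ upper triangular matrices with the elementary $\mathbb{Z}_2$-grading induced by the alternating sequence $(0,1,0,1,\ldots)$ of length $n$, endowed with the super-reflection superinvolution $\bar\circ$. Then the image of the polynomial $f(y^+,z^+)=y^+z^+$ on $A$, that is, the set $$\{\,uv \mid u\in A_0^+,\ v\in A_1^+\,\},$$ is not a vector subspace of $A$.
   Context: The elementary $\mathbb{Z}_2$-grading on $UT_n(F)$ induced by $(g_1,\dots,g_n)\in\mathbb{Z}_2^n$ is $A_0=\mathrm{span}_F\{e_{kj}: k\le j,\ g_k+g_j=0\}$, $A_1=\mathrm{span}_F\{e_{kj}: k\le j,\ g_k+g_j=1\}$; for the sequence $(0,1,0,1,\dots)$, $e_{ij}$ is even iff $j-i$ is even. For this grading, the super-reflection superinvolution $\bar\circ$ is the linear map given on matrix units ($1\le i\le j\le n$) by $$e_{ij}^{\bar\circ}=\varepsilon_{j-i}\,e_{n+1-j,\,n+1-i},\qquad \varepsilon_k=\begin{cases}1& k\equiv0,1\pmod 4,\\ -1& k\equiv2,3\pmod4.\end{cases}$$ It preserves the grading, has order 2 and satisfies $(ab)^{\bar\circ}=(-1)^{|a||b|}b^{\bar\circ}a^{\bar\circ}$ for homogeneous $a,b$. Put $A_i^+=\{a\in A_i: a^{\bar\circ}=a\}$, $i=0,1$. The variable $y^+$ is evaluated in $A_0^+$ and $z^+$ in $A_1^+$. *)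

theory Defs
  imports "Jordan_Normal_Form.VS_Connect" "HOL-Library.Z2"
begin

text \<open>Rows and columns are numbered from \<^term>\<open>0::nat\<close>, as usual for \<^typ>\<open>'a mat\<close>: the matrix unit
  with row \<open>i\<close> and column \<open>j\<close> counted from 1 is \<open>mat_unit n (i - 1) (j - 1)\<close>.\<close>

definition mat_unit :: "nat \<Rightarrow> nat \<Rightarrow> nat \<Rightarrow> 'a::field mat" where
  "mat_unit n i j = mat n n (\<lambda>(k, l). if k = i \<and> l = j then 1 else 0)"

definition UT :: "'a::field itself \<Rightarrow> nat \<Rightarrow> ('a, 'a mat) module" where
  "UT ty n = (module_mat ty n n)\<lparr>carrier := {M \<in> carrier_mat n n. upper_triangular M}\<rparr>"

definition elementary_component ::
    "'a::field itself \<Rightarrow> nat \<Rightarrow> (nat \<Rightarrow> bit) \<Rightarrow> bit \<Rightarrow> 'a mat set" where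
  "elementary_component ty n g d =
     LinearCombinations.module.span class_ring (UT ty n)
       {mat_unit n k j | k j. k \<le> j \<and> j < n \<and> g k + g j = d}"

definition alternating :: "nat \<Rightarrow> bit" where
  "alternating i = (if even i then 0 else 1)"

definition super_sign :: "nat \<Rightarrow> 'a::field" where
  "super_sign k = (if k mod 4 = 0 \<or> k mod 4 = 1 then 1 else - 1)"

text \<open>The linear extension of the prescription on matrix units. In 0-based indexing the reflection
  of the index \<open>i\<close> is \<open>n - 1 - i\<close>.\<close>

definition super_reflection :: "nat \<Rightarrow> 'a::field mat \<Rightarrow> 'a mat" where
  "super_reflection n M =
     finsum (UT TYPE('a) n)
       (\<lambda>(i, j). M $$ (i, j) \<cdot>\<^sub>m (super_sign (j - i) \<cdot>\<^sub>m mat_unit n (n - 1 - j) (n - 1 - i)))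
       {(i, j). i \<le> j \<and> j < n}"

definition symmetric_component :: "'a::field itself \<Rightarrow> nat \<Rightarrow> bit \<Rightarrow> 'a mat set" where
  "symmetric_component ty n d =
     {a \<in> elementary_component ty n alternating d. super_reflection n a = a}"

text \<open>The predicate \<^const>\<open>VectorSpace.subspace\<close> includes the requirement that the ambient structure
  is a vector space; lemma \<open>vectorspace_UT\<close> shows that it holds here.\<close>

lemma UT_simps:
  "carrier (UT ty n) = {M \<in> carrier_mat n n. upper_triangular M}"
  "add (UT ty n) = (+)"
  "zero (UT ty n) = 0\<^sub>m n n"
  "smult (UT ty n) = (\<cdot>\<^sub>m)"
  by (auto simp: UT_def module_mat_def)

lemma vectorspace_UT: "vectorspace (class_ring :: 'a::field ring) (UT TYPE('a) n)"
proof -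
  interpret V: vectorspace "class_ring :: 'a ring" "module_mat TYPE('a) n n"
    by (rule matrix_vs)
  have "submodule (class_ring :: 'a ring) {M \<in> carrier_mat n n. upper_triangular M}
          (module_mat TYPE('a) n n)"
    by unfold_locales (auto simp: module_mat_simps upper_triangular_def)
  then have "subspace (class_ring :: 'a ring) {M \<in> carrier_mat n n. upper_triangular M}
          (module_mat TYPE('a) n n)"
    by (simp add: VectorSpace.subspace_def V.vectorspace_axioms)
  from V.subspace_is_vs[OF this] show ?thesis
    by (simp add: UT_def)
qed

lemma mat_unit_in_UT: "i \<le> j \<Longrightarrow> mat_unit n i j \<in> carrier (UT TYPE('a::field) n)"
  by (auto simp: UT_simps mat_unit_def upper_triangular_def)

lemma finsum_UT_index:
  fixes f :: "'b \<Rightarrow> 'a::field mat"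
  assumes "finite S" and "\<And>x. x \<in> S \<Longrightarrow> f x \<in> carrier (UT TYPE('a) n)"
    and kl: "k < n" "l < n"
  shows "finsum (UT TYPE('a) n) f S $$ (k, l) = (\<Sum>x\<in>S. f x $$ (k, l))"
    and "finsum (UT TYPE('a) n) f S \<in> carrier (UT TYPE('a) n)"
proof -
  interpret U: vectorspace "class_ring :: 'a ring" "UT TYPE('a) n" by (rule vectorspace_UT)
  have "finsum (UT TYPE('a) n) f S $$ (k, l) = (\<Sum>x\<in>S. f x $$ (k, l)) \<and>
        finsum (UT TYPE('a) n) f S \<in> carrier (UT TYPE('a) n)"
    using assms(1,2)
  proof (induction S rule: finite_induct)
    case empty
    then show ?case using kl by (simp add: UT_simps)
  next
    case (insert x S)
    then have "finsum (UT TYPE('a) n) f (insert x S) = f x \<oplus>\<^bsub>UT TYPE('a) n\<^esub> finsum (UT TYPE('a) n) f S"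
      by (intro U.finsum_insert) auto
    moreover have "f x \<in> carrier (UT TYPE('a) n)" "finsum (UT TYPE('a) n) f S \<in> carrier (UT TYPE('a) n)"
      using insert by auto
    moreover have "f x \<oplus>\<^bsub>UT TYPE('a) n\<^esub> finsum (UT TYPE('a) n) f S \<in> carrier (UT TYPE('a) n)"
      using calculation by (intro U.add.m_closed)
    ultimately show ?case using insert kl by (auto simp: UT_simps)
  qed
  then show "finsum (UT TYPE('a) n) f S $$ (k, l) = (\<Sum>x\<in>S. f x $$ (k, l))"
    and "finsum (UT TYPE('a) n) f S \<in> carrier (UT TYPE('a) n)" by auto
qed

lemma super_reflection_closed:
  fixes M :: "'a::field mat"
  shows "super_reflection n M \<in> carrier (UT TYPE('a) n)"
proof -
  interpret U: vectorspace "class_ring :: 'a ring" "UT TYPE('a) n" by (rule vectorspace_UT)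
  show ?thesis unfolding super_reflection_def
    by (rule U.finsum_closed) (auto simp: UT_simps mat_unit_def upper_triangular_def)
qed

lemma super_reflection_index:
  fixes M :: "'a::field mat"
  assumes "k \<le> l" "l < n"
  shows "super_reflection n M $$ (k, l) = super_sign (l - k) * M $$ (n - 1 - l, n - 1 - k)"
proof -
  let ?S = "{(i, j). i \<le> j \<and> j < n}"
  let ?f = "\<lambda>(i, j). M $$ (i, j) \<cdot>\<^sub>m (super_sign (j - i) \<cdot>\<^sub>m mat_unit n (n - 1 - j) (n - 1 - i))"
  have fin: "finite ?S"
    by (rule finite_subset[of _ "{..<n} \<times> {..<n}"]) auto
  have "super_reflection n M $$ (k, l) = (\<Sum>x\<in>?S. ?f x $$ (k, l))"
    unfolding super_reflection_def
    by (rule finsum_UT_index) (use fin assms in \<open>auto simp: UT_simps mat_unit_def upper_triangular_def\<close>)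
  also have "\<dots> = (\<Sum>x\<in>?S. if x = (n - 1 - l, n - 1 - k)
      then super_sign (l - k) * M $$ (n - 1 - l, n - 1 - k) else 0)"
  proof (rule sum.cong[OF refl])
    fix x assume "x \<in> ?S"
    then obtain i j where x: "x = (i, j)" "i \<le> j" "j < n" by auto
    have eq: "k = n - 1 - j \<and> l = n - 1 - i \<longleftrightarrow> i = n - 1 - l \<and> j = n - 1 - k"
      using x assms by linarith
    have "j - i = l - k" if "i = n - 1 - l" "j = n - 1 - k"
      using that x assms by linarith
    then show "?f x $$ (k, l) = (if x = (n - 1 - l, n - 1 - k)
        then super_sign (l - k) * M $$ (n - 1 - l, n - 1 - k) else 0)"
      using x assms eq by (auto simp: mat_unit_def)
  qed
  also have "\<dots> = super_sign (l - k) * M $$ (n - 1 - l, n - 1 - k)"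
    using fin assms by (subst sum.delta) auto
  finally show ?thesis .
qed

lemma super_reflection_mat_unit:
  assumes "i \<le> j" "j < n"
  shows "super_reflection n (mat_unit n i j :: 'a::field mat)
           = super_sign (j - i) \<cdot>\<^sub>m mat_unit n (n - 1 - j) (n - 1 - i)"
proof (rule eq_matI)
  fix k l
  assume "k < dim_row (super_sign (j - i) \<cdot>\<^sub>m mat_unit n (n - 1 - j) (n - 1 - i) :: 'a mat)"
    and "l < dim_col (super_sign (j - i) \<cdot>\<^sub>m mat_unit n (n - 1 - j) (n - 1 - i) :: 'a mat)"
  then have kl: "k < n" "l < n" by (simp_all add: mat_unit_def)
  show "super_reflection n (mat_unit n i j :: 'a mat) $$ (k, l)
      = (super_sign (j - i) \<cdot>\<^sub>m mat_unit n (n - 1 - j) (n - 1 - i)) $$ (k, l)"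
  proof (cases "k \<le> l")
    case True
    have eq: "k = n - 1 - j \<and> l = n - 1 - i \<longleftrightarrow> n - 1 - l = i \<and> n - 1 - k = j"
      using assms kl by linarith
    have "l - k = j - i" if "k = n - 1 - j" "l = n - 1 - i"
      using that assms by linarith
    then show ?thesis
      using True kl assms eq by (auto simp: super_reflection_index mat_unit_def)
  next
    case False
    then show ?thesis
      using kl assms super_reflection_closed[of n "mat_unit n i j :: 'a mat"]
      by (auto simp: UT_simps upper_triangular_def mat_unit_def)
  qed
next
  show "dim_row (super_reflection n (mat_unit n i j :: 'a mat))
      = dim_row (super_sign (j - i) \<cdot>\<^sub>m mat_unit n (n - 1 - j) (n - 1 - i) :: 'a mat)"
    "dim_col (super_reflection n (mat_unit n i j :: 'a mat))
      = dim_col (super_sign (j - i) \<cdot>\<^sub>m mat_unit n (n - 1 - j) (n - 1 - i) :: 'a mat)"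
    using super_reflection_closed[of n "mat_unit n i j :: 'a mat"]
    by (auto simp: UT_simps mat_unit_def)
qed

lemma super_reflection_linear:
  "super_reflection n \<in> LinearCombinations.module_hom (class_ring :: 'a::field ring) (UT TYPE('a) n) (UT TYPE('a) n)"
proof -
  have eqI: "A = B" if "A \<in> carrier (UT TYPE('a) n)" "B \<in> carrier (UT TYPE('a) n)"
      "\<And>k l. k \<le> l \<Longrightarrow> l < n \<Longrightarrow> A $$ (k, l) = B $$ (k, l)" for A B :: "'a mat"
  proof (rule eq_matI)
    fix k l assume "k < dim_row B" "l < dim_col B"
    then show "A $$ (k, l) = B $$ (k, l)"
      using that by (cases "k \<le> l") (auto simp: UT_simps upper_triangular_def)
  qed (use that in \<open>auto simp: UT_simps\<close>)
  interpret U: vectorspace "class_ring :: 'a ring" "UT TYPE('a) n" by (rule vectorspace_UT)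
  show ?thesis
    unfolding LinearCombinations.module_hom_def mem_Collect_eq
  proof (intro conjI allI impI Pi_I)
    fix M N :: "'a mat" assume MN: "M \<in> carrier (UT TYPE('a) n) \<and> N \<in> carrier (UT TYPE('a) n)"
    show "super_reflection n (M \<oplus>\<^bsub>UT TYPE('a) n\<^esub> N)
        = super_reflection n M \<oplus>\<^bsub>UT TYPE('a) n\<^esub> super_reflection n N"
    proof (rule eqI)
      show "super_reflection n M \<oplus>\<^bsub>UT TYPE('a) n\<^esub> super_reflection n N \<in> carrier (UT TYPE('a) n)"
        by (intro U.add.m_closed super_reflection_closed)
    qed (use MN super_reflection_closed[of n M] super_reflection_closed[of n N]
          super_reflection_closed[of n "M + N"] in
        \<open>auto simp: super_reflection_index UT_simps algebra_simps\<close>)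
  next
    fix c :: 'a and M :: "'a mat"
    assume cM: "c \<in> carrier class_ring \<and> M \<in> carrier (UT TYPE('a) n)"
    show "super_reflection n (c \<odot>\<^bsub>UT TYPE('a) n\<^esub> M) = c \<odot>\<^bsub>UT TYPE('a) n\<^esub> super_reflection n M"
    proof (rule eqI)
      show "c \<odot>\<^bsub>UT TYPE('a) n\<^esub> super_reflection n M \<in> carrier (UT TYPE('a) n)"
        by (intro U.smult_closed super_reflection_closed) simp
    qed (use cM super_reflection_closed[of n M] super_reflection_closed[of n "c \<cdot>\<^sub>m M"] in
        \<open>auto simp: super_reflection_index UT_simps\<close>)
  qed (rule super_reflection_closed)
qed

end

theory Submission
  imports Defs
begin

text \<open>
  The product of an even symmetric \<open>u\<close> and an odd symmetric \<open>v\<close> is determined on the first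
  superdiagonal by the diagonal \<open>d\<close> of \<open>u\<close> and the first superdiagonal \<open>w\<close> of \<open>v\<close>: its entry at
  \<open>(k, k + 1)\<close> is \<open>d k * w k\<close>, because \<open>v\<close> has zero diagonal. The signs of the superinvolution on
  these two lines are \<open>+1\<close>, so symmetry makes \<open>d\<close> and \<open>w\<close> palindromes.
  Hence the entries of \<open>u * v\<close> at positions \<open>(0, 1)\<close>, \<open>(1, 2)\<close> and \<open>(n - 2, n - 1)\<close> are
  \<open>d 0 * w 0\<close>, \<open>d 1 * w 1\<close> and \<open>d 1 * w 0\<close>: when the first two are nonzero, so is the third
  (\<open>mult_corner_entry_nonzero\<close>).

  This implication is not preserved by sums. If, apart from mirror images, only \<open>d 0\<close>
  and \<open>w 0\<close> are nonzero, then only the first of the three entries of the product is nonzero; if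
  only \<open>d 1\<close> and \<open>w 1\<close> are nonzero, then only the second is; the sum of the two products
  violates the implication. For this the three positions must be distinct, which is where
  \<open>n \<ge> 4\<close> enters.
\<close>

lemma mat_unit_index [simp]:
  "k < n \<Longrightarrow> l < n \<Longrightarrow> mat_unit n i j $$ (k, l) = (if k = i \<and> l = j then 1 else 0)"
  by (simp add: mat_unit_def)

lemma mat_unit_carrier [simp]: "mat_unit n i j \<in> carrier_mat n n"
  by (simp add: mat_unit_def)

lemma elementary_component_entry:
  fixes M :: "'a::field mat"
  assumes M: "M \<in> elementary_component TYPE('a) n g d"
  shows "M \<in> carrier (UT TYPE('a) n)"
    and "k < n \<Longrightarrow> l < n \<Longrightarrow> g k + g l \<noteq> d \<Longrightarrow> M $$ (k, l) = 0"
proof -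
  interpret U: vectorspace "class_ring :: 'a ring" "UT TYPE('a) n" by (rule vectorspace_UT)
  let ?S = "{mat_unit n k j | k j. k \<le> j \<and> j < n \<and> g k + g j = d} :: 'a mat set"
  have S: "?S \<subseteq> carrier (UT TYPE('a) n)"
    by (auto intro: mat_unit_in_UT)
  have M': "M \<in> U.span ?S"
    using M by (simp add: elementary_component_def)
  then show "M \<in> carrier (UT TYPE('a) n)"
    using U.span_is_subset2[OF S] by blast
  from M' obtain a A where A: "finite A" "A \<subseteq> ?S"
    and Ma: "M = finsum (UT TYPE('a) n) (\<lambda>B. a B \<cdot>\<^sub>m B) A"
    by (auto simp: U.span_def U.lincomb_def UT_simps)
  assume kl: "k < n" "l < n" "g k + g l \<noteq> d"
  have "a B \<cdot>\<^sub>m B \<in> carrier (UT TYPE('a) n)" if "B \<in> A" for B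
  proof -
    have "B \<in> carrier (UT TYPE('a) n)"
      using that A(2) S by blast
    then show ?thesis by (auto simp: UT_simps upper_triangular_def)
  qed
  then have "M $$ (k, l) = (\<Sum>B\<in>A. (a B \<cdot>\<^sub>m B) $$ (k, l))"
    unfolding Ma by (intro finsum_UT_index(1) A(1) kl(1,2))
  also have "\<dots> = 0"
  proof (rule sum.neutral, rule ballI)
    fix B assume "B \<in> A"
    then obtain i j where "B = mat_unit n i j" "g i + g j = d"
      using A(2) by auto
    then show "(a B \<cdot>\<^sub>m B) $$ (k, l) = 0"
      using kl by (auto simp: mat_unit_def)
  qed
  finally show "M $$ (k, l) = 0" .
qed

text \<open>The sum of a matrix unit and its mirror image in the antidiagonal supplies the witnesses.
  On the diagonal and the first superdiagonal the superinvolution is that reflection with sign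
  \<open>+1\<close>, so the sum is fixed. A matrix unit on the antidiagonal is its own mirror image and gets
  doubled.\<close>

definition mirror_unit :: "nat \<Rightarrow> nat \<Rightarrow> nat \<Rightarrow> 'a::field mat" where
  "mirror_unit n i j = mat_unit n i j + mat_unit n (n - 1 - j) (n - 1 - i)"

lemma mirror_unit_carrier [simp]: "mirror_unit n i j \<in> carrier_mat n n"
  by (simp add: mirror_unit_def)

lemma mirror_unit_index [simp]:
  assumes "k < n" "l < n"
  shows "mirror_unit n i j $$ (k, l) =
    (if k = i \<and> l = j then 1 else 0) + (if k = n - 1 - j \<and> l = n - 1 - i then 1 else 0)"
  unfolding mirror_unit_def
  by (subst index_add_mat) (use assms in \<open>auto simp: mat_unit_def\<close>)

lemma mirror_unit_symmetric:
  assumes j: "j = i \<or> j = Suc i" "j < n" and d: "alternating i + alternating j = d"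
  shows "(mirror_unit n i j :: 'a::field mat) \<in> symmetric_component TYPE('a) n d"
proof -
  interpret U: vectorspace "class_ring :: 'a ring" "UT TYPE('a) n" by (rule vectorspace_UT)
  let ?S = "{mat_unit n k j | k j. k \<le> j \<and> j < n \<and> alternating k + alternating j = d}
    :: 'a mat set"
  let ?i = "n - 1 - j" and ?j = "n - 1 - i"
  let ?e = "mat_unit n i j :: 'a mat" and ?e' = "mat_unit n ?i ?j :: 'a mat"
  have S: "?S \<subseteq> carrier (UT TYPE('a) n)"
    by (auto intro: mat_unit_in_UT)
  have j': "?j = ?i \<or> ?j = Suc ?i" "?i \<le> ?j" "?j < n" "n - 1 - ?j = i" "n - 1 - ?i = j"
    using j by auto
  have d': "alternating ?i + alternating ?j = d"
    using d j(1) j'(1) j(2) by (auto simp: alternating_def)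
  have "i \<le> j"
    using j(1) by auto
  then have e: "?e \<in> ?S" "?e' \<in> ?S"
    using j(2) d j'(2,3) d' by blast+
  have "?e \<oplus>\<^bsub>UT TYPE('a) n\<^esub> ?e' \<in> U.span ?S"
    by (intro U.span_add1[OF S] subsetD[OF U.in_own_span[OF S]] e)
  then have comp: "mirror_unit n i j \<in> elementary_component TYPE('a) n alternating d"
    by (simp add: elementary_component_def UT_simps mirror_unit_def)
  have sign: "super_sign (j - i) = (1::'a)" "super_sign (?j - ?i) = (1::'a)"
    using j j' by (auto simp: super_sign_def)
  have swap: "super_reflection n ?e = ?e'" "super_reflection n ?e' = ?e"
    using j j' sign by (auto simp: super_reflection_mat_unit)
  have "super_reflection n (?e \<oplus>\<^bsub>UT TYPE('a) n\<^esub> ?e')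
      = super_reflection n ?e \<oplus>\<^bsub>UT TYPE('a) n\<^esub> super_reflection n ?e'"
    using super_reflection_linear[of n, where ?'a = 'a] subsetD[OF S e(1)] subsetD[OF S e(2)]
    by (simp add: LinearCombinations.module_hom_def)
  then have "super_reflection n (mirror_unit n i j :: 'a mat) = mirror_unit n i j"
    unfolding swap by (simp add: UT_simps mirror_unit_def comm_add_mat[of _ n n])
  with comp show ?thesis
    by (simp add: symmetric_component_def)
qed

lemma mult_superdiagonal_entry:
  fixes u v :: "'a::field mat"
  assumes u: "u \<in> carrier_mat n n" "upper_triangular u"
    and v: "v \<in> carrier_mat n n" "upper_triangular v" "\<And>k. k < n \<Longrightarrow> v $$ (k, k) = 0"
    and k: "Suc k < n"
  shows "(u * v) $$ (k, Suc k) = u $$ (k, k) * v $$ (k, Suc k)"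
proof -
  have "(u * v) $$ (k, Suc k) = (\<Sum>i = 0..<n. u $$ (k, i) * v $$ (i, Suc k))"
    using u v k by (simp add: scalar_prod_def)
  also have "\<dots> = (\<Sum>i = 0..<n. if i = k then u $$ (k, k) * v $$ (k, Suc k) else 0)"
  proof (rule sum.cong[OF refl])
    fix i assume i: "i \<in> {0..<n}"
    consider "i < k" | "i = k" | "i = Suc k" | "Suc k < i" by linarith
    then show "u $$ (k, i) * v $$ (i, Suc k) = (if i = k then u $$ (k, k) * v $$ (k, Suc k) else 0)"
      by cases (use i u v k in \<open>auto simp: upper_triangular_def\<close>)
  qed
  also have "\<dots> = u $$ (k, k) * v $$ (k, Suc k)"
    using k by simp
  finally show ?thesis .
qed

lemma symmetric_componentD:
  fixes M :: "'a::field mat"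
  assumes M: "M \<in> symmetric_component TYPE('a) n d"
  shows "M \<in> carrier_mat n n" and "upper_triangular M"
    and "\<And>k. d = 1 \<Longrightarrow> k < n \<Longrightarrow> M $$ (k, k) = 0"
    and "\<And>k l. k \<le> l \<Longrightarrow> l < n \<Longrightarrow> M $$ (k, l) = super_sign (l - k) * M $$ (n - 1 - l, n - 1 - k)"
proof -
  have E: "M \<in> elementary_component TYPE('a) n alternating d" and R: "super_reflection n M = M"
    using M by (auto simp: symmetric_component_def)
  show "M \<in> carrier_mat n n" "upper_triangular M"
    using elementary_component_entry(1)[OF E] by (auto simp: UT_simps)
  show "M $$ (k, k) = 0" if "d = 1" "k < n" for k
    using elementary_component_entry(2)[OF E that(2) that(2)] that(1)
    by (simp add: alternating_def split: if_splits)
  show "M $$ (k, l) = super_sign (l - k) * M $$ (n - 1 - l, n - 1 - k)"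
    if "k \<le> l" "l < n" for k l
    using super_reflection_index[OF that, of M] R by simp
qed

lemma mult_symmetric_superdiagonal_entry:
  fixes u v :: "'a::field mat"
  assumes "u \<in> symmetric_component TYPE('a) n 0" "v \<in> symmetric_component TYPE('a) n 1"
    and "Suc k < n"
  shows "(u * v) $$ (k, Suc k) = u $$ (k, k) * v $$ (k, Suc k)"
  using assms by (intro mult_superdiagonal_entry) (auto dest: symmetric_componentD)

text \<open>By the palindromic symmetry, the last superdiagonal entry of \<open>u * v\<close> combines the factor of
  \<open>u\<close> used at \<open>(1, 2)\<close> with the factor of \<open>v\<close> used at \<open>(0, 1)\<close>.\<close>

lemma mult_corner_entry_nonzero:
  fixes u v :: "'a::field mat"
  assumes n: "n \<ge> 3"
    and u: "u \<in> symmetric_component TYPE('a) n 0" and v: "v \<in> symmetric_component TYPE('a) n 1"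
    and nz: "(u * v) $$ (0, 1) \<noteq> 0" "(u * v) $$ (1, 2) \<noteq> 0"
  shows "(u * v) $$ (n - 2, n - 1) \<noteq> 0"
proof -
  note entry = mult_symmetric_superdiagonal_entry[OF u v]
  have last: "Suc (n - 2) = n - 1" and n1: "n - 1 - (n - 2) = 1"
    using n by auto
  have "v $$ (0, 1) \<noteq> 0"
    using entry[of 0] nz(1) n by auto
  moreover have "u $$ (1, 1) \<noteq> 0"
    using entry[of 1] nz(2) n by (auto simp: numeral_2_eq_2)
  moreover have "u $$ (n - 2, n - 2) = u $$ (1, 1)"
    using symmetric_componentD(4)[OF u, of "n - 2" "n - 2"] n n1 by (simp add: super_sign_def)
  moreover have "v $$ (n - 2, n - 1) = v $$ (0, 1)"
    using symmetric_componentD(4)[OF v, of "n - 2" "n - 1"] n n1 by (simp add: super_sign_def)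
  ultimately show ?thesis
    using entry[of "n - 2"] n last by simp
qed

theorem theorem19:
  fixes n :: nat
  assumes "n \<ge> 4"
  shows "\<not> VectorSpace.subspace (class_ring :: 'a::field_char_0 ring)
           {u * v | u v. u \<in> symmetric_component TYPE('a) n 0
                       \<and> v \<in> symmetric_component TYPE('a) n 1}
           (UT TYPE('a) n)"
proof
  let ?I = "{u * v | u v. u \<in> symmetric_component TYPE('a) n 0
                       \<and> v \<in> symmetric_component TYPE('a) n 1}"
  assume "VectorSpace.subspace (class_ring :: 'a ring) ?I (UT TYPE('a) n)"
  then have sub: "submodule (class_ring :: 'a ring) ?I (UT TYPE('a) n)"
    by (simp add: VectorSpace.subspace_def)
  define u1 v1 u2 v2 :: "'a mat"
    where "u1 = mirror_unit n 0 0" and "v1 = mirror_unit n 0 1"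
      and "u2 = mirror_unit n 1 1" and "v2 = mirror_unit n 1 2"
  have mem: "u1 \<in> symmetric_component TYPE('a) n 0" "v1 \<in> symmetric_component TYPE('a) n 1"
    "u2 \<in> symmetric_component TYPE('a) n 0" "v2 \<in> symmetric_component TYPE('a) n 1"
    unfolding u1_def v1_def u2_def v2_def
    by (rule mirror_unit_symmetric; use assms in \<open>simp add: alternating_def\<close>)+
  have "u1 * v1 \<in> ?I" "u2 * v2 \<in> ?I"
    using mem by blast+
  then have "u1 * v1 + u2 * v2 \<in> ?I"
    using submodule.m_closed[OF sub] by (simp add: UT_simps)
  then obtain u v where uv: "u \<in> symmetric_component TYPE('a) n 0"
      "v \<in> symmetric_component TYPE('a) n 1" and eq: "u1 * v1 + u2 * v2 = u * v"
    by auto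
  have entry: "(u * v) $$ (k, Suc k)
      = u1 $$ (k, k) * v1 $$ (k, Suc k) + u2 $$ (k, k) * v2 $$ (k, Suc k)" if "Suc k < n" for k
  proof -
    have "(u * v) $$ (k, Suc k) = (u1 * v1) $$ (k, Suc k) + (u2 * v2) $$ (k, Suc k)"
      unfolding eq[symmetric] using that
      by (subst index_add_mat) (auto simp: u2_def v2_def mirror_unit_def mat_unit_def)
    then show ?thesis
      using that mem by (simp add: mult_symmetric_superdiagonal_entry)
  qed
  have "(u * v) $$ (0, 1) \<noteq> 0"
    using entry[of 0] assms by (simp add: u1_def v1_def u2_def v2_def)
  \<comment> \<open>For \<open>n = 4\<close> the position \<open>(1, 2)\<close> is its own mirror image and the entry there is 2.\<close>
  moreover have "(u * v) $$ (1, 2) \<noteq> 0"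
    using entry[of 1] assms by (auto simp: u1_def v1_def u2_def v2_def numeral_2_eq_2)
  moreover have "(u * v) $$ (n - 2, n - 1) = 0"
  proof -
    have "Suc (n - 2) = n - 1"
      using assms by simp
    then show ?thesis
      using entry[of "n - 2"] assms by (auto simp: u1_def v1_def u2_def v2_def)
  qed
  ultimately show False
    using mult_corner_entry_nonzero[OF _ uv] assms by simp
qed

end
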